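(* Let $n\ge1$. (i) For the star $S_n$ on $n+1$ vertices, $\pi_{fl}(S_n)=2$. (ii) For every subdivision $S$ of a star $S_n$, $\pi_{fl}(S)\le5$. (iii) For the wheel $W_n$ on $n+1$ vertices ($n\ge3$), with its standard plane embedding, $\pi_{fl}(W_n)\le 6$.
   Context: The star $S_n$ is obtained by joining one central vertex to the $n$ vertices of an independent set; the wheel $W_n$ is obtained by joining a central vertex to all $n$ vertices of a cycle. A sequence $r_1\dots r_{2n}$ is a repetition if $r_i=r_{n+i}$ for all $i\le n$. In a plane graph $G$, a facial path is a path whose vertices and edges are consecutive on the boundary walk of some face of $G$. A vertex colouring is facial non-repetitive if no facial path on vertices $v_1,\dots,v_{2n}$ ($n\ge1$) has colour sequence that is a repetition. $\pi_{fl}(G)$ is the minimum $l$ such that for every assignment of lists $L(v)\subseteq\mathbb{Z}_+$ with $|L(v)|\ge l$ there is a facial non-repetitive colouring $\varphi$ with $\varphi(v)\in L(v)$ for every vertex $v$. *)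

theory Defs
  imports Graph_Theory.Graph_Theory "HOL-Combinatorics.Cycles"
begin

section \<open>Plane graphs\<close>

text \<open>
  A finite simple graph is a symmetric loop-free \<^typ>\<open>'a pair_pre_digraph\<close>: every edge
  \<open>{u, v}\<close> is represented by its two orientations \<open>(u, v)\<close> and \<open>(v, u)\<close>. An embedding is given
  by its rotation system: \<open>rot (v, x) = (v, y)\<close> says that \<open>vy\<close> is the edge following \<open>vx\<close> in the
  cyclic order of the edges around \<open>v\<close>. A boundary walk that has traversed \<open>(u, v)\<close> continues with
  the arc following \<open>(v, u)\<close> around \<open>v\<close>, so the boundary walks of the faces are the orbits of
  \<open>face_succ rot\<close>.
\<close>

definition face_succ :: "('a \<times> 'a \<Rightarrow> 'a \<times> 'a) \<Rightarrow> 'a \<times> 'a \<Rightarrow> 'a \<times> 'a" where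
  "face_succ rot = rot \<circ> prod.swap"

text \<open>
  Faces are represented by the arcs of their boundary walks; the graph with a single vertex has
  one face, whose boundary has no arcs.
\<close>

definition faces :: "'a pair_pre_digraph \<Rightarrow> ('a \<times> 'a \<Rightarrow> 'a \<times> 'a) \<Rightarrow> ('a \<times> 'a) set set" where
  "faces G rot = (if parcs G = {} then {{}} else orbit (face_succ rot) ` parcs G)"

text \<open>
  Connected plane graphs are the connected graphs with a rotation system of genus 0, that is,
  satisfying Euler's formula. The choice of the outer face is not recorded, as facial paths do not
  depend on it.
\<close>

locale plane_graph = pair_graph G for G :: "'a pair_pre_digraph" +
  fixes rot :: "'a \<times> 'a \<Rightarrow> 'a \<times> 'a"
  assumes connected: "connected (with_proj G)"
    and rot_permutes: "rot permutes parcs G"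
    and rot_cyclic: "\<And>v. out_arcs (with_proj G) v \<noteq> {} \<Longrightarrow> cyclic_on rot (out_arcs (with_proj G) v)"
    and euler: "card (pverts G) + card (faces G rot) = card (parcs G) div 2 + 2"

text \<open>
  A path is given by its list of vertices. It may run along a boundary walk or against it.
\<close>

definition follows_face :: "('a \<times> 'a \<Rightarrow> 'a \<times> 'a) \<Rightarrow> 'a list \<Rightarrow> bool" where
  "follows_face rot p \<longleftrightarrow> successively (\<lambda>a b. b = face_succ rot a) (vwalk_arcs p)"

definition facial_path :: "'a pair_pre_digraph \<Rightarrow> ('a \<times> 'a \<Rightarrow> 'a \<times> 'a) \<Rightarrow> 'a list \<Rightarrow> bool" where
  "facial_path G rot p \<longleftrightarrow>
     vpath p (with_proj G) \<and> (follows_face rot p \<or> follows_face rot (rev p))"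

section \<open>Facial non-repetitive list colourings\<close>

definition repetition :: "'c list \<Rightarrow> bool" where
  "repetition r \<longleftrightarrow> (\<exists>n\<ge>1. length r = 2 * n \<and> (\<forall>i<n. r ! i = r ! (n + i)))"

definition facial_nonrepetitive ::
    "'a pair_pre_digraph \<Rightarrow> ('a \<times> 'a \<Rightarrow> 'a \<times> 'a) \<Rightarrow> ('a \<Rightarrow> 'c) \<Rightarrow> bool" where
  "facial_nonrepetitive G rot \<phi> \<longleftrightarrow> (\<forall>p. facial_path G rot p \<longrightarrow> \<not> repetition (map \<phi> p))"

text \<open>Lists may be infinite, in which case \<^const>\<open>card\<close> does not measure their size.\<close>

definition facial_choosable ::
    "'a pair_pre_digraph \<Rightarrow> ('a \<times> 'a \<Rightarrow> 'a \<times> 'a) \<Rightarrow> nat \<Rightarrow> bool" where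
  "facial_choosable G rot l \<longleftrightarrow>
     (\<forall>L :: 'a \<Rightarrow> nat set.
        (\<forall>v\<in>pverts G. L v \<subseteq> {0<..} \<and> (infinite (L v) \<or> l \<le> card (L v))) \<longrightarrow>
        (\<exists>\<phi>. facial_nonrepetitive G rot \<phi> \<and> (\<forall>v\<in>pverts G. \<phi> v \<in> L v)))"

definition pi_fl :: "'a pair_pre_digraph \<Rightarrow> ('a \<times> 'a \<Rightarrow> 'a \<times> 'a) \<Rightarrow> nat" where
  "pi_fl G rot = (LEAST l. facial_choosable G rot l)"

text \<open>The minimum exists: with lists of size \<open>|V|\<close> one can give all vertices distinct colours.\<close>

lemma injective_choice:
  fixes L :: "'a \<Rightarrow> 'c set"
  assumes "finite V" and "\<And>v. v \<in> V \<Longrightarrow> infinite (L v) \<or> card V \<le> card (L v)"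
  shows "\<exists>\<phi>. inj_on \<phi> V \<and> (\<forall>v\<in>V. \<phi> v \<in> L v)"
  using assms
proof (induction V)
  case (insert v V)
  have "infinite (L u) \<or> card V \<le> card (L u)" if "u \<in> V" for u
    using insert.prems[of u] insert.hyps that by auto
  then obtain \<phi> where \<phi>: "inj_on \<phi> V" "\<forall>u\<in>V. \<phi> u \<in> L u"
    using insert.IH by blast
  have "\<not> L v \<subseteq> \<phi> ` V"
  proof
    assume sub: "L v \<subseteq> \<phi> ` V"
    then have "finite (L v)" "card (L v) \<le> card V"
      using insert.hyps(1) by (auto intro: finite_subset surj_card_le)
    then show False
      using insert.prems[of v] insert.hyps by auto
  qed
  then obtain c where c: "c \<in> L v" "c \<notin> \<phi> ` V"
    by blast
  have "inj_on (\<phi>(v := c)) (insert v V)" "\<forall>u\<in>insert v V. (\<phi>(v := c)) u \<in> L u"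
    using \<phi> c insert.hyps(2) by (auto simp: inj_on_def)
  then show ?case
    by blast
qed simp

lemma facial_choosable_card:
  assumes "finite (pverts G)"
  shows "facial_choosable G rot (card (pverts G))"
  unfolding facial_choosable_def
proof (intro allI impI)
  fix L :: "'a \<Rightarrow> nat set"
  assume "\<forall>v\<in>pverts G. L v \<subseteq> {0<..} \<and> (infinite (L v) \<or> card (pverts G) \<le> card (L v))"
  then obtain \<phi> where \<phi>: "inj_on \<phi> (pverts G)" "\<forall>v\<in>pverts G. \<phi> v \<in> L v"
    using injective_choice[of "pverts G" L] assms by auto
  have "\<not> repetition (map \<phi> p)" if "facial_path G rot p" for p
  proof
    assume "repetition (map \<phi> p)"
    then obtain n where n: "n \<ge> 1" "length p = 2 * n" "\<phi> (p ! 0) = \<phi> (p ! n)"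
      by (force simp: repetition_def)
    have p: "distinct p" "set p \<subseteq> pverts G"
      using that by (auto simp: facial_path_def vpath_def vwalk_def)
    then have "p ! 0 = p ! n"
      using n inj_onD[OF \<phi>(1), of "p ! 0" "p ! n"] by (auto simp: subset_iff)
    then show False
      using n p by (auto simp: nth_eq_iff_index_eq)
  qed
  then show "\<exists>\<phi>. facial_nonrepetitive G rot \<phi> \<and> (\<forall>v\<in>pverts G. \<phi> v \<in> L v)"
    using \<phi> by (auto simp: facial_nonrepetitive_def)
qed

section \<open>Stars and wheels\<close>

definition star_graph :: "'a \<Rightarrow> 'a set \<Rightarrow> 'a pair_pre_digraph" where
  "star_graph c A = \<lparr>pverts = insert c A, parcs = {c} \<times> A \<union> A \<times> {c}\<rparr>"

definition is_star :: "nat \<Rightarrow> 'a pair_pre_digraph \<Rightarrow> bool" where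
  "is_star n G \<longleftrightarrow> (\<exists>c A. finite A \<and> card A = n \<and> c \<notin> A \<and> G = star_graph c A)"

text \<open>
  The wheel with hub \<open>h\<close> and rim cycle \<open>xs\<close> (a list of distinct vertices, in cyclic order);
  \<^term>\<open>cycle_of_list xs\<close> maps every vertex of the rim to the next one.
\<close>

definition wheel_graph :: "'a \<Rightarrow> 'a list \<Rightarrow> 'a pair_pre_digraph" where
  "wheel_graph h xs =
     \<lparr>pverts = insert h (set xs),
      parcs = {h} \<times> set xs \<union> set xs \<times> {h}
        \<union> (\<lambda>x. (x, cycle_of_list xs x)) ` set xs
        \<union> (\<lambda>x. (cycle_of_list xs x, x)) ` set xs\<rparr>"

text \<open>
  The standard embedding: the hub lies inside the rim cycle, which is drawn counterclockwise. The
  counterclockwise order is that of the rim around the hub, and next rim vertex, hub, previous rim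
  vertex around each rim vertex.
\<close>

definition wheel_rot :: "'a \<Rightarrow> 'a list \<Rightarrow> 'a \<times> 'a \<Rightarrow> 'a \<times> 'a" where
  "wheel_rot h xs = (\<lambda>(u, v).
     let next = cycle_of_list xs; prev = inv next in
     if (u, v) \<notin> parcs (wheel_graph h xs) then (u, v)
     else if u = h then (h, next v)
     else if v = next u then (u, h)
     else if v = h then (u, prev u)
     else (u, next u))"

lemma orbit_3:
  assumes "f a = b" "f b = c" "f c = a"
  shows "orbit f a = {a, b, c}"
proof
  show "orbit f a \<subseteq> {a, b, c}"
  proof
    fix z assume "z \<in> orbit f a"
    then show "z \<in> {a, b, c}"
      by induction (use assms in auto)
  qed
  have "b \<in> orbit f a"
    using orbit.base[of f a] assms by simp
  moreover from orbit.step[OF this] have "c \<in> orbit f a"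
    using assms by simp
  moreover from orbit.step[OF this] have "a \<in> orbit f a"
    using assms by simp
  ultimately show "{a, b, c} \<subseteq> orbit f a"
    by simp
qed

lemma orbit_image:
  assumes "\<And>x. x \<in> V \<Longrightarrow> g (f x) = f (r x)" "\<And>x. x \<in> V \<Longrightarrow> r x \<in> V" "x \<in> V"
  shows "orbit g (f x) = f ` orbit r x"
proof -
  have "(r ^^ k) x \<in> V" for k
    by (induction k) (use assms in auto)
  then have "(g ^^ k) (f x) = f ((r ^^ k) x)" for k
    by (induction k) (use assms in auto)
  then show ?thesis
    by (auto simp: orbit_altdef)
qed

theorem plane_graph_wheel:
  fixes h :: 'a
  assumes "distinct (h # xs)" "3 \<le> length xs"
  shows "plane_graph (wheel_graph h xs) (wheel_rot h xs)"
proof -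
  define n V r G rot where "n = length xs" and "V = set xs" and "r = cycle_of_list xs"
    and "G = wheel_graph h xs" and "rot = wheel_rot h xs"
  have xs: "distinct xs" "3 \<le> n" "h \<notin> V" "finite V" "card V = n"
    using assms by (auto simp: n_def V_def distinct_card)
  have r_perm: "r permutes V"
    by (simp add: r_def V_def cycle_permutes)
  have r_pow: "(r ^^ k) (xs ! i) = xs ! ((k + i) mod n)" if "i < n" for k i
  proof -
    have "(r ^^ k) (xs ! i) = map (r ^^ k) xs ! i"
      using that by (simp add: n_def)
    also have "\<dots> = rotate k xs ! i"
      using cyclic_rotation[OF xs(1), of k] by (simp add: r_def)
    finally show ?thesis
      using that by (simp add: n_def nth_rotate)
  qed
  have V_conv: "\<exists>i<n. x = xs ! i" if "x \<in> V" for x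
    using that by (auto simp: V_def n_def in_set_conv_nth)
  have r_V [simp]: "r x \<in> V \<longleftrightarrow> x \<in> V" and r_V' [simp]: "inv r x \<in> V \<longleftrightarrow> x \<in> V" for x
    using permutes_in_image[OF r_perm] permutes_in_image[OF permutes_inv[OF r_perm]] by auto
  have inv_r [simp]: "inv r (r x) = x" "r (inv r x) = x" for x
    using permutes_inverses[OF r_perm] by auto
  have r_inj [simp]: "r x = r y \<longleftrightarrow> x = y" for x y
    by (metis inv_r(1))
  have pow_neq: "(r ^^ k) x \<noteq> x" if x: "x \<in> V" and k: "0 < k" "k < n" for k x
  proof -
    obtain i where i: "i < n" "x = xs ! i"
      using V_conv[OF x] by blast
    have "(k + i) mod n \<noteq> i"
      using i k by (cases "k + i < n") (auto simp: mod_if)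
    moreover have "(k + i) mod n < n"
      using xs(2) by simp
    ultimately have "xs ! ((k + i) mod n) \<noteq> xs ! i"
      using i(1) nth_eq_iff_index_eq[OF xs(1)] by (simp add: n_def)
    then show ?thesis
      using i(2) r_pow[OF i(1), of k] by simp
  qed
  have r1: "r x \<noteq> x" and r2: "r (r x) \<noteq> x" if "x \<in> V" for x
    using pow_neq[OF that, of 1] pow_neq[OF that, of 2] xs(2) by (auto simp: eval_nat_numeral)
  have orbit_r: "orbit r x = V" if x: "x \<in> V" for x
  proof
    show "orbit r x \<subseteq> V"
      by (rule permutes_orbit_subset[OF r_perm x])
    show "V \<subseteq> orbit r x"
    proof
      fix y assume "y \<in> V"
      then obtain i j where i: "i < n" "x = xs ! i" and j: "j < n" "y = xs ! j"
        using V_conv x by meson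
      have "(r ^^ (n + j - i)) x = y"
        using i j r_pow[OF i(1), of "n + j - i"] by auto
      moreover have "n + j - i > 0"
        using i by simp
      ultimately show "y \<in> orbit r x"
        by (auto simp: orbit_altdef)
    qed
  qed
  have parcs: "parcs G = {h} \<times> V \<union> V \<times> {h} \<union> (\<lambda>x. (x, r x)) ` V \<union> (\<lambda>x. (r x, x)) ` V"
    and pverts: "pverts G = insert h V"
    by (simp_all add: G_def wheel_graph_def V_def r_def)
  have rot_def': "rot (u, v) =
      (if (u, v) \<notin> parcs G then (u, v) else if u = h then (h, r v)
       else if v = r u then (u, h) else if v = h then (u, inv r u) else (u, r u))" for u v
    by (simp add: rot_def wheel_rot_def G_def r_def Let_def)
  have Vh: "x \<noteq> h" if "x \<in> V" for x
    using that xs by auto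
  have rh: "r x \<noteq> h" if "x \<in> V" for x
    using that xs r_V by metis
  have rot_simps:
    "rot (h, x) = (h, r x)" "rot (x, r x) = (x, h)" "rot (x, h) = (x, inv r x)"
    "rot (x, inv r x) = (x, r x)" "rot (r x, x) = (r x, r (r x))"
    "rot (r x, h) = (r x, x)" if x: "x \<in> V" for x
  proof -
    show "rot (h, x) = (h, r x)" "rot (x, r x) = (x, h)"
      using x Vh[OF x] by (auto simp: rot_def' parcs)
    show "rot (x, h) = (x, inv r x)"
      using x Vh[OF x] rh[OF x] by (auto simp: rot_def' parcs)
    have *: "rot (r y, y) = (r y, r (r y))" if y: "y \<in> V" for y
      using y Vh[OF y] rh[OF y] r2[OF y] by (auto simp: rot_def' parcs)
    from this[OF x] show "rot (r x, x) = (r x, r (r x))" .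
    show "rot (x, inv r x) = (x, r x)"
      using *[of "inv r x"] x by simp
    show "rot (r x, h) = (r x, x)"
      using x rh[OF x] rh[of "r x"] by (auto simp: rot_def' parcs)
  qed
  have surj: "parcs G \<subseteq> rot ` parcs G"
  proof -
    have "(h, x) \<in> rot ` parcs G" "(x, h) \<in> rot ` parcs G"
      "(x, r x) \<in> rot ` parcs G" "(r x, x) \<in> rot ` parcs G" if x: "x \<in> V" for x
    proof -
      have "rot (h, inv r x) = (h, x)" "(h, inv r x) \<in> parcs G"
        using rot_simps(1)[of "inv r x"] x by (auto simp: parcs)
      then show "(h, x) \<in> rot ` parcs G"
        by (metis imageI)
      show "(x, h) \<in> rot ` parcs G"
        using rot_simps(2)[OF x] x by (intro image_eqI[of _ _ "(x, r x)"]) (auto simp: parcs)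
      have "(x, inv r x) \<in> parcs G"
        using x by (auto simp: parcs intro!: image_eqI[of _ _ "inv r x"])
      then show "(x, r x) \<in> rot ` parcs G"
        using rot_simps(4)[OF x] by (metis imageI)
      show "(r x, x) \<in> rot ` parcs G"
        using rot_simps(6)[OF x] x by (intro image_eqI[of _ _ "(r x, h)"]) (auto simp: parcs)
    qed
    then show ?thesis
      by (auto simp: parcs)
  qed
  have fin: "finite (parcs G)"
    using xs by (simp add: parcs)
  have maps: "rot a \<in> parcs G" if "a \<in> parcs G" for a
  proof -
    have mem: "(h, x) \<in> parcs G" "(x, h) \<in> parcs G" "(x, r x) \<in> parcs G" "(r x, x) \<in> parcs G"
      "(x, inv r x) \<in> parcs G" if "x \<in> V" for x
      using that by (auto simp: parcs intro: image_eqI[of _ _ "inv r x"])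
    have "rot (u, v) \<in> parcs G" if uv: "(u, v) \<in> parcs G" for u v
    proof -
      consider "u = h" "v \<in> V" | "u \<in> V" "v = h" | "u \<in> V" "v = r u" | "v \<in> V" "u = r v"
        using uv by (auto simp: parcs)
      then show ?thesis
        by cases (simp_all add: rot_simps mem)
    qed
    then show ?thesis
      using that by (cases a) auto
  qed
  have rot_image: "rot ` parcs G = parcs G"
    using surj maps by blast
  then have rot_bij: "bij_betw rot (parcs G) (parcs G)"
    using fin by (simp add: bij_betw_def eq_card_imp_inj_on)
  have rot_perm: "rot permutes parcs G"
    by (rule bij_imp_permutes[OF rot_bij]) (auto simp: rot_def')
  define \<phi> where "\<phi> = face_succ rot"
  have \<phi>: "\<phi> (x, r x) = (r x, r (r x))" "\<phi> (r x, x) = (x, h)" "\<phi> (x, h) = (h, r x)"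
      "\<phi> (h, r x) = (r x, x)" if "x \<in> V" for x
    using that by (simp_all add: \<phi>_def face_succ_def rot_simps)
  define R where "R = (\<lambda>x. (x, r x)) ` V"
  define T where "T x = {(r x, x), (x, h), (h, r x)}" for x
  have orbit_R: "orbit \<phi> (x, r x) = R" if "x \<in> V" for x
    using orbit_image[of V \<phi> "\<lambda>x. (x, r x)" r x] that orbit_r by (simp add: \<phi> R_def)
  have orbit_T: "orbit \<phi> (r x, x) = T x" "orbit \<phi> (x, h) = T x" "orbit \<phi> (h, r x) = T x"
    if x: "x \<in> V" for x
    using orbit_3[of \<phi>, OF \<phi>(2)[OF x] \<phi>(3)[OF x] \<phi>(4)[OF x]]
      orbit_3[of \<phi>, OF \<phi>(3)[OF x] \<phi>(4)[OF x] \<phi>(2)[OF x]]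
      orbit_3[of \<phi>, OF \<phi>(4)[OF x] \<phi>(2)[OF x] \<phi>(3)[OF x]]
    by (auto simp: T_def)
  have hV: "{h} \<times> V = (\<lambda>x. (h, r x)) ` V"
    using permutes_image[OF r_perm] by auto
  have V_ne: "V \<noteq> {}"
    using xs by auto
  have "orbit \<phi> ` parcs G = insert R (T ` V)"
  proof -
    have "V \<times> {h} = (\<lambda>x. (x, h)) ` V"
      by auto
    then have "orbit \<phi> ` parcs G = T ` V \<union> T ` V \<union> (\<lambda>x. R) ` V \<union> T ` V"
      by (simp add: parcs hV image_Un image_image orbit_R orbit_T cong: image_cong_simp)
    then show ?thesis
      using V_ne by auto
  qed
  then have faces: "faces G rot = insert R (T ` V)"
    using V_ne by (auto simp: faces_def \<phi>_def parcs)
  have "inj_on T V"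
  proof (rule inj_onI)
    fix x y assume xy: "x \<in> V" "y \<in> V" "T x = T y"
    then have "(x, h) \<in> T y"
      by (auto simp: T_def)
    then show "x = y"
      using xy Vh by (auto simp: T_def)
  qed
  moreover have "R \<notin> T ` V"
  proof
    assume "R \<in> T ` V"
    then obtain x where "x \<in> V" "(x, h) \<in> R"
      by (auto simp: T_def)
    then show False
      using rh by (auto simp: R_def)
  qed
  ultimately have card_faces: "card (faces G rot) = n + 1"
    using xs by (simp add: faces card_image)
  have card_parcs: "card (parcs G) = 4 * n"
  proof -
    have 1: "card ({h} \<times> V) = n" "card (V \<times> {h}) = n"
      using xs by (simp_all add: card_cartesian_product)
    have 2: "card ((\<lambda>x. (x, r x)) ` V) = n" "card ((\<lambda>x. (r x, x)) ` V) = n"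
      using xs by (auto simp: card_image inj_on_def)
    have 3: "({h} \<times> V) \<inter> (V \<times> {h}) = {}"
      "({h} \<times> V \<union> V \<times> {h}) \<inter> (\<lambda>x. (x, r x)) ` V = {}"
      "({h} \<times> V \<union> V \<times> {h} \<union> (\<lambda>x. (x, r x)) ` V) \<inter> (\<lambda>x. (r x, x)) ` V = {}"
      using Vh rh r2 by (auto, (metis r_V)+)
    show ?thesis
      unfolding parcs using xs(4) 1 2 3 by (simp add: card_Un_disjoint)
  qed
  have "pair_graph G"
    by unfold_locales
      (use xs r1 r1[symmetric] in \<open>auto simp: parcs pverts arc_to_ends_def symmetric_def sym_def rev_image_eqI\<close>)
  then interpret G: pair_graph G .
  have "mk_symmetric (with_proj G) = G"
  proof -
    have "(\<Union>e\<in>parcs G. {(fst e, snd e), (snd e, fst e)}) = parcs G"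
      using G.graph_symmetric by fastforce
    then show ?thesis
      by (simp add: mk_symmetric_def)
  qed
  moreover have "strongly_connected (with_proj G)"
  proof -
    have "h \<rightarrow>\<^sup>*\<^bsub>with_proj G\<^esub> u \<and> u \<rightarrow>\<^sup>*\<^bsub>with_proj G\<^esub> h" if u: "u \<in> pverts G" for u
    proof (cases "u = h")
      case True
      then show ?thesis
        using u by (simp add: G.reachable_refl)
    next
      case False
      then have "(h, u) \<in> parcs G" "(u, h) \<in> parcs G"
        using u by (auto simp: pverts parcs)
      then show ?thesis
        by (simp add: G.reachable_adjI)
    qed
    then have "\<forall>u\<in>pverts G. \<forall>v\<in>pverts G. u \<rightarrow>\<^sup>*\<^bsub>with_proj G\<^esub> v"
      by (meson G.reachable_trans)
    then show ?thesis
      by (simp add: strongly_connected_def pverts)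
  qed
  ultimately have conn: "connected (with_proj G)"
    by (simp add: connected_def)
  have cyc: "cyclic_on rot (out_arcs (with_proj G) v)" if ne: "out_arcs (with_proj G) v \<noteq> {}" for v
  proof (cases "v = h")
    case True
    obtain x where x: "x \<in> V"
      using V_ne by blast
    have "out_arcs (with_proj G) v = Pair h ` V"
      using True Vh rh by (auto simp: out_arcs_def parcs)
    moreover have "orbit rot (h, x) = Pair h ` V"
      using orbit_image[of V rot "Pair h" r x] x orbit_r rot_simps(1) by simp
    ultimately show ?thesis
      using x by (auto simp: cyclic_on_def)
  next
    case False
    then have v: "v \<in> V"
      using ne by (auto simp: out_arcs_def parcs)
    have "orbit rot (v, r v) = {(v, r v), (v, h), (v, inv r v)}"
      by (rule orbit_3) (use v rot_simps in auto)
    moreover have "out_arcs (with_proj G) v = {(v, r v), (v, h), (v, inv r v)}"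
      using v False by (auto simp: out_arcs_def parcs intro: image_eqI[of _ _ "inv r v"])
    ultimately show ?thesis
      by (auto simp: cyclic_on_def)
  qed
  have "plane_graph G rot"
    by unfold_locales
      (use conn rot_perm cyc card_faces card_parcs xs in \<open>auto simp: pverts\<close>)
  then show ?thesis
    by (simp add: G_def rot_def)
qed

end

theory Submission
  imports Defs "HOL-Library.Sublist"
begin

text \<open>
  Lists of four colours suffice for paths: by Rosenfeld's counting argument, every new vertex at
  least doubles the number of non-repetitive colourings. If the colours of \<open>k\<close> vertices occur
  nowhere else, then no repetition runs through these vertices. Hence a graph that becomes a subgraph
  of a path when \<open>k\<close> vertices are deleted can be coloured from lists of \<open>k + 4\<close> colours. For a
  subdivided star one deletes the centre, for a wheel the hub and one vertex of the rim.
\<close>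

section \<open>Non-repetitive words\<close>

lemma repetition_iff: "repetition r \<longleftrightarrow> (\<exists>u. u \<noteq> [] \<and> r = u @ u)"
proof
  assume "repetition r"
  then obtain n where n: "n \<ge> 1" "length r = 2 * n" "\<forall>i<n. r ! i = r ! (n + i)"
    by (auto simp: repetition_def)
  then have "take n r = drop n r"
    by (intro nth_equalityI) auto
  then have "r = take n r @ take n r"
    by (metis append_take_drop_id)
  moreover have "take n r \<noteq> []"
    using n by auto
  ultimately show "\<exists>u. u \<noteq> [] \<and> r = u @ u"
    by blast
next
  assume "\<exists>u. u \<noteq> [] \<and> r = u @ u"
  then obtain u where "u \<noteq> []" "r = u @ u"
    by blast
  then show "repetition r"
    unfolding repetition_def by (intro exI[of _ "length u"]) (auto simp: nth_append Suc_le_eq)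
qed

lemma repetition_rev [simp]: "repetition (rev r) \<longleftrightarrow> repetition r"
  unfolding repetition_iff by (metis rev_append rev_is_Nil_conv rev_rev_ident)

definition nonrepetitive :: "'c list \<Rightarrow> bool" where
  "nonrepetitive w \<longleftrightarrow> (\<forall>r. sublist r w \<longrightarrow> \<not> repetition r)"

lemma nonrepetitive_sublist: "nonrepetitive w \<Longrightarrow> sublist v w \<Longrightarrow> nonrepetitive v"
  by (simp add: nonrepetitive_def sublist_order.order.trans[of _ v w])

text \<open>As \<open>w\<close> contains no repetition, any repetition in \<open>x # w\<close> has
  to start at \<open>x\<close>.\<close>

lemma repetition_prefix_if_Cons:
  assumes "nonrepetitive w" "\<not> nonrepetitive (x # w)"
  obtains u v where "u \<noteq> []" "x # w = u @ u @ v"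
  using assms unfolding nonrepetitive_def
  by (auto simp: sublist_Cons_right prefix_def repetition_iff)

section \<open>Counting non-repetitive choices from lists of four colours\<close>

definition nonrepetitive_choices :: "'c set list \<Rightarrow> 'c list set" where
  "nonrepetitive_choices As = {w. list_all2 (\<in>) w As \<and> nonrepetitive w}"

lemma finite_nonrepetitive_choices:
  assumes "\<forall>A\<in>set As. finite A"
  shows "finite (nonrepetitive_choices As)"
proof (rule finite_subset)
  show "nonrepetitive_choices As \<subseteq> {w. set w \<subseteq> \<Union>(set As) \<and> length w = length As}"
    by (fastforce simp: nonrepetitive_choices_def list_all2_conv_all_nth in_set_conv_nth)
  show "finite {w. set w \<subseteq> \<Union>(set As) \<and> length w = length As}"
    using assms by (intro finite_lists_length_eq) auto
qed

text \<open>A bad extension \<open>x # w = u @ u @ v\<close> is determined by \<open>u @ v\<close> and the length of \<open>u\<close>.\<close>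

lemma Cons_nonrepetitive_choices:
  "(\<lambda>(x, w). x # w) ` (A \<times> nonrepetitive_choices As) \<subseteq> nonrepetitive_choices (A # As) \<union>
     (\<Union>k\<in>{..length As}. (\<lambda>u. take (Suc k) u @ u) ` nonrepetitive_choices (drop k As))"
proof clarify
  fix x w
  assume x: "x \<in> A" and w: "w \<in> nonrepetitive_choices As"
    and "x # w \<notin> (\<Union>k\<in>{..length As}. (\<lambda>u. take (Suc k) u @ u) ` nonrepetitive_choices (drop k As))"
  then have no: "x # w \<noteq> take (Suc k) u @ u"
    if "k \<le> length As" "u \<in> nonrepetitive_choices (drop k As)" for k u
    using that by blast
  have "nonrepetitive (x # w)"
  proof (rule ccontr)
    assume "\<not> nonrepetitive (x # w)"
    moreover have "nonrepetitive w"
      using w by (simp add: nonrepetitive_choices_def)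
    ultimately obtain u v where uv: "u \<noteq> []" "x # w = u @ u @ v"
      by (elim repetition_prefix_if_Cons)
    \<comment> \<open>As \<open>u\<close> begins with \<open>x\<close>, only its other
      \<open>k\<close> letters lie in \<open>w\<close>, and dropping them leaves
      \<open>u @ v\<close>. From this word and \<open>k\<close> one recovers
      \<open>u = take (Suc k) (u @ v)\<close>.\<close>
    then obtain k where k: "length u = Suc k"
      by (cases u) auto
    have dw: "drop k w = u @ v"
      using uv k by (metis append_eq_conv_conj drop_Suc_Cons)
    have "length w = length As"
      using w by (auto simp: nonrepetitive_choices_def dest: list_all2_lengthD)
    moreover have "Suc (length w) \<ge> 2 * Suc k"
      using arg_cong[OF uv(2), of length] k by simp
    moreover have "drop k w \<in> nonrepetitive_choices (drop k As)"
      using w by (auto simp: nonrepetitive_choices_def intro: list_all2_dropI nonrepetitive_sublist[of w])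
    ultimately show False
      using no[of k "drop k w"] uv dw k by simp
  qed
  then show "x # w \<in> nonrepetitive_choices (A # As)"
    using x w by (simp add: nonrepetitive_choices_def)
qed

text \<open>Of the four extensions per word, at most as many in total are bad as the sum counts,
  hence at most two per word on average. So the count doubles from \<open>As\<close> to
  \<open>A # As\<close>, and doubling keeps the sum over all suffixes below twice its largest term.
  The sum is part of the claim in order to serve as induction hypothesis.\<close>

lemma card_nonrepetitive_choices:
  assumes "\<forall>A\<in>set As. card A = 4"
  shows "(\<Sum>k\<le>length As. card (nonrepetitive_choices (drop k As)))
           \<le> 2 * card (nonrepetitive_choices As) \<and> 0 < card (nonrepetitive_choices As)"
  using assms
proof (induction As)
  case Nil
  have "nonrepetitive_choices ([] :: 'a set list) = {[]}"
    by (auto simp: nonrepetitive_choices_def nonrepetitive_def repetition_iff)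
  then show ?case
    by simp
next
  case (Cons A As)
  let ?g = "nonrepetitive_choices"
  \<comment> \<open>Cardinality 4 forces each list to be finite, as \<open>card\<close> is 0 on
    infinite sets.\<close>
  have fin: "finite (?g (drop k (A # As)))" for k
    using Cons.prems
    by (intro finite_nonrepetitive_choices) (metis card.infinite in_set_dropD zero_neq_numeral)
  have finAs: "finite (?g (drop k As))" for k
    using fin[of "Suc k"] by simp
  have "4 * card (?g As) = card ((\<lambda>(x, w). x # w) ` (A \<times> ?g As))"
    using Cons.prems by (subst card_image) (auto simp: inj_on_def card_cartesian_product)
  also have "\<dots> \<le> card (?g (A # As) \<union>
      (\<Union>k\<in>{..length As}. (\<lambda>u. take (Suc k) u @ u) ` ?g (drop k As)))"
    using fin[of 0] finAs by (intro card_mono Cons_nonrepetitive_choices) auto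
  also have "\<dots> \<le> card (?g (A # As)) +
      card (\<Union>k\<in>{..length As}. (\<lambda>u. take (Suc k) u @ u) ` ?g (drop k As))"
    by (rule card_Un_le)
  also have "card (\<Union>k\<in>{..length As}. (\<lambda>u. take (Suc k) u @ u) ` ?g (drop k As))
      \<le> (\<Sum>k\<le>length As. card ((\<lambda>u. take (Suc k) u @ u) ` ?g (drop k As)))"
    by (rule card_UN_le) simp
  also have "\<dots> \<le> (\<Sum>k\<le>length As. card (?g (drop k As)))"
    by (intro sum_mono card_image_le finAs)
  finally have double: "2 * card (?g As) \<le> card (?g (A # As))"
    using Cons by simp
  have "(\<Sum>k\<le>length (A # As). card (?g (drop k (A # As))))
      = card (?g (A # As)) + (\<Sum>k\<le>length As. card (?g (drop k As)))"
    by (simp add: sum.atMost_Suc_shift del: sum.atMost_Suc)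
  then show ?case
    using Cons double by simp
qed

lemma ex_map_eq:
  assumes "length w = length xs" "distinct xs"
  shows "\<exists>\<phi>. map \<phi> xs = w"
  using assms
proof (induction w xs rule: list_induct2)
  case (Cons y ys x xs)
  then obtain \<phi> where "map \<phi> xs = ys"
    by auto
  then have "map (\<phi>(x := y)) (x # xs) = y # ys"
    using Cons.prems by auto
  then show ?case
    by (intro exI[of _ "\<phi>(x := y)"])
qed simp

lemma ex_nonrepetitive_colouring:
  assumes "distinct xs" "\<And>v. v \<in> set xs \<Longrightarrow> card (M v) = 4"
  shows "\<exists>\<phi>. (\<forall>v\<in>set xs. \<phi> v \<in> M v) \<and> nonrepetitive (map \<phi> xs)"
proof -
  have "nonrepetitive_choices (map M xs) \<noteq> {}"
    using card_nonrepetitive_choices[of "map M xs"] assms(2) by fastforce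
  then obtain w where w: "list_all2 (\<in>) w (map M xs)" "nonrepetitive w"
    by (auto simp: nonrepetitive_choices_def)
  have "length w = length xs"
    using w(1) by (auto dest: list_all2_lengthD)
  then obtain \<phi> where "map \<phi> xs = w"
    using ex_map_eq assms(1) by blast
  moreover from this have "\<forall>v\<in>set xs. \<phi> v \<in> M v"
    using w(1) by (auto simp: list_all2_map1 list_all2_map2 list_all2_same)
  ultimately show ?thesis
    using w(2) by blast
qed

section \<open>Graphs that are close to a path\<close>

text \<open>The vertex \<open>b\<close> occurs only once in \<open>xs\<close>, so the two
  occurrences can be glued there.\<close>

lemma sublist_pair_Cons:
  assumes "distinct xs" "sublist [a, b] xs" "sublist (b # q) xs"
  shows "sublist (a # b # q) xs"
proof -
  obtain us vs us' vs' where xs: "xs = us @ a # b # vs" "xs = us' @ b # q @ vs'"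
    using assms(2,3) unfolding sublist_def append_Cons append_Nil by blast
  then have "(us @ [a]) @ b # vs = us' @ b # (q @ vs')"
    by simp
  moreover have "b \<notin> set (us @ [a])" "b \<notin> set vs"
    using assms(1) xs(1) by auto
  ultimately have "vs = q @ vs'"
    by (subst (asm) append_Cons_eq_iff) auto
  then show ?thesis
    using xs(1) sublist_appendI[of "a # b # q" us vs'] by simp
qed

lemma sublist_pair_unique:
  assumes "distinct xs" "sublist [b, a] xs" "sublist (b # c # q) xs"
  shows "a = c"
proof -
  obtain us vs us' vs' where xs: "xs = us @ b # a # vs" "xs = us' @ b # c # q @ vs'"
    using assms(2,3) unfolding sublist_def append_Cons append_Nil by blast
  moreover have "b \<notin> set us" "b \<notin> set (a # vs)"
    using assms(1) xs(1) by auto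
  ultimately show ?thesis
    using append_Cons_eq_iff[of b us "a # vs" us' "c # q @ vs'"] by simp
qed

text \<open>If \<open>a\<close> precedes \<open>b\<close> in \<open>xs\<close>, the walk grows at
  its front. If \<open>a\<close> follows \<open>b\<close>, it would be the first entry of
  \<open>q\<close>, which is excluded unless \<open>q\<close> is empty; then the reversed pair is
  the sublist sought.\<close>

lemma sublist_extend:
  assumes "distinct xs" "sublist (b # q) xs" "a \<notin> set q" "sublist [a, b] xs \<or> sublist [b, a] xs"
  shows "sublist (a # b # q) xs \<or> sublist (rev (a # b # q)) xs"
  using assms(4)
proof
  assume "sublist [a, b] xs"
  then show ?thesis
    by (intro disjI1 sublist_pair_Cons[OF assms(1) _ assms(2)])
next
  assume ba: "sublist [b, a] xs"
  show ?thesis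
  proof (cases q)
    case Nil
    then show ?thesis
      using ba by simp
  next
    case (Cons c q')
    then have "a = c"
      using sublist_pair_unique[OF assms(1) ba] assms(2) by simp
    then show ?thesis
      using Cons assms(3) by simp
  qed
qed

text \<open>A path cannot turn around: stepping back in \<open>xs\<close> would visit a vertex
  twice. The induction adds vertices at the front of the path.\<close>

lemma walk_along_list:
  assumes "distinct xs" "distinct p" "set p \<subseteq> set xs"
    and "\<forall>(a, b)\<in>set (vwalk_arcs p). sublist [a, b] xs \<or> sublist [b, a] xs"
  shows "sublist p xs \<or> sublist (rev p) xs"
  using assms(2-)
proof (induction p rule: vwalk_arcs.induct)
  case (2 x)
  then show ?case
    by (simp add: sublist_def in_set_conv_decomp)
next
  case (3 a b q)
  then have ab: "a \<notin> set q" "sublist [a, b] xs \<or> sublist [b, a] xs"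
    by auto
  have "sublist (b # q) xs \<or> sublist (rev (b # q)) xs"
    using 3 by auto
  then show ?case
  proof
    assume "sublist (b # q) xs"
    then show ?thesis
      using sublist_extend assms(1) ab by fast
  next
    \<comment> \<open>Neighbourhood in the list is symmetric, so this is the forward case for
      \<open>rev xs\<close>.\<close>
    assume "sublist (rev (b # q)) xs"
    then have "sublist (b # q) (rev xs)"
      by (simp add: sublist_rev_right)
    moreover have "sublist [a, b] (rev xs) \<or> sublist [b, a] (rev xs)"
      using ab(2) by (auto simp: sublist_rev_right)
    ultimately have "sublist (a # b # q) (rev xs) \<or> sublist (rev (a # b # q)) (rev xs)"
      using sublist_extend[of "rev xs"] assms(1) ab(1) by simp
    then show ?thesis
      unfolding sublist_rev_right rev_rev_ident by blast
  qed
qed simp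

section \<open>Private colours on a deleted set of vertices\<close>

text \<open>Both halves of a repetition carry the same colours, while the two halves of
  \<open>p\<close> share no vertex.\<close>

lemma repetition_colour_twice:
  assumes "repetition (map \<phi> p)" "distinct p" "x \<in> set p"
  obtains y where "y \<in> set p" "y \<noteq> x" "\<phi> y = \<phi> x"
proof -
  obtain u p1 p2 where p: "p = p1 @ p2" "map \<phi> p1 = u" "map \<phi> p2 = u"
    using assms(1) unfolding repetition_iff map_eq_append_conv by metis
  then have "\<phi> ` set p1 = \<phi> ` set p2"
    by (metis list.set_map)
  moreover have "set p1 \<inter> set p2 = {}"
    using p(1) assms(2) by simp
  ultimately show ?thesis
    using that assms(3) unfolding p(1) set_append by (smt (verit) Un_iff disjoint_iff imageE imageI)
qed

lemma facial_pathD: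
  assumes "facial_path G rot p"
  shows "distinct p" "set p \<subseteq> pverts G" "set (vwalk_arcs p) \<subseteq> parcs G"
  using assms by (auto simp: facial_path_def vpath_def vwalk_def arcs_ends_def arc_to_ends_def)

lemma vwalk_arcs_subset: "set (vwalk_arcs p) \<subseteq> set p \<times> set p"
  by (induction p rule: vwalk_arcs.induct) auto

text \<open>Consecutive entries of \<open>xs\<close> may be non-adjacent in \<open>G\<close>. This
  allows several components of the graph without \<open>C\<close> to be laid end to end in one
  list.\<close>

lemma facial_choosable_near_path:
  assumes C: "finite C" and xs: "distinct xs" and V: "pverts G = C \<union> set xs" "C \<inter> set xs = {}"
    and E: "\<And>a b. (a, b) \<in> parcs G \<Longrightarrow> a \<notin> C \<Longrightarrow> b \<notin> C \<Longrightarrow> sublist [a, b] xs \<or> sublist [b, a] xs"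
  shows "facial_choosable G rot (card C + 4)"
  unfolding facial_choosable_def
proof (intro allI impI)
  fix L :: "'a \<Rightarrow> nat set"
  assume L: "\<forall>v\<in>pverts G. L v \<subseteq> {0<..} \<and> (infinite (L v) \<or> card C + 4 \<le> card (L v))"
  have "\<exists>\<gamma>. inj_on \<gamma> C \<and> (\<forall>v\<in>C. \<gamma> v \<in> L v)"
    by (rule injective_choice[OF C]) (use L V in fastforce)
  then obtain \<gamma> where \<gamma>: "inj_on \<gamma> C" "\<forall>v\<in>C. \<gamma> v \<in> L v"
    by blast
  \<comment> \<open>Reserving the colours of \<open>C\<close> costs each list at most
    \<open>card C\<close> entries. The rest is cut down to exactly four, the size that the counting
    lemma is stated for.\<close>
  have "\<exists>M. M \<subseteq> L v - \<gamma> ` C \<and> card M = 4" if v: "v \<in> set xs" for v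
  proof (cases "finite (L v)")
    case True
    then have "4 + card C \<le> card (L v)"
      using L V(1) v by auto
    moreover have "card (L v) - card (\<gamma> ` C) \<le> card (L v - \<gamma> ` C)"
      using C by (intro diff_card_le_card_Diff) simp
    ultimately have "4 \<le> card (L v - \<gamma> ` C)"
      using card_image_le[OF C, of \<gamma>] by linarith
    then show ?thesis
      using obtain_subset_with_card_n by metis
  next
    case False
    then have "infinite (L v - \<gamma> ` C)"
      using C by simp
    then show ?thesis
      using infinite_arbitrarily_large by metis
  qed
  then obtain M where M: "\<And>v. v \<in> set xs \<Longrightarrow> M v \<subseteq> L v - \<gamma> ` C \<and> card (M v) = 4"
    by metis
  then obtain \<psi> where \<psi>: "\<forall>v\<in>set xs. \<psi> v \<in> M v" "nonrepetitive (map \<psi> xs)"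
    using ex_nonrepetitive_colouring[OF xs, of M] by blast
  define \<phi> where "\<phi> v = (if v \<in> C then \<gamma> v else \<psi> v)" for v
  have xs_C: "v \<notin> C" if "v \<in> set xs" for v
    using that V(2) by auto
  then have \<phi>_xs: "nonrepetitive (map \<phi> xs)"
    using \<psi>(2) by (simp add: \<phi>_def cong: map_cong)
  have unique: "v = c" if "c \<in> C" "v \<in> pverts G" "\<phi> v = \<phi> c" for c v
    using that M \<psi>(1) \<gamma>(1) V(1) by (fastforce simp: \<phi>_def inj_on_def split: if_splits)
  have "facial_nonrepetitive G rot \<phi>"
    unfolding facial_nonrepetitive_def
  proof (intro allI impI notI)
    fix p assume "facial_path G rot p" and rep: "repetition (map \<phi> p)"
    note p = facial_pathD[OF this(1)]
    \<comment> \<open>A repetition through \<open>c\<close> would show the colour of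
      \<open>c\<close> on a second vertex, but that colour is private to \<open>c\<close>.\<close>
    have avoid: "c \<notin> C" if c: "c \<in> set p" for c
    proof
      assume "c \<in> C"
      moreover obtain y where "y \<in> set p" "y \<noteq> c" "\<phi> y = \<phi> c"
        using repetition_colour_twice[OF rep p(1) c] .
      ultimately show False
        using unique p(2) by blast
    qed
    then have "set p \<subseteq> set xs"
      using p(2) V(1) by blast
    moreover have "\<forall>(a, b)\<in>set (vwalk_arcs p). sublist [a, b] xs \<or> sublist [b, a] xs"
      using E p(3) avoid vwalk_arcs_subset[of p] by blast
    ultimately have "sublist p xs \<or> sublist (rev p) xs"
      using walk_along_list[OF xs p(1)] by blast
    then have "sublist (map \<phi> p) (map \<phi> xs) \<or> sublist (rev (map \<phi> p)) (map \<phi> xs)"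
      by (auto simp: rev_map intro: map_mono_sublist)
    then show False
      using \<phi>_xs rep repetition_rev unfolding nonrepetitive_def by blast
  qed
  moreover have "\<forall>v\<in>pverts G. \<phi> v \<in> L v"
    using \<gamma>(2) \<psi>(1) M V(1) by (fastforce simp: \<phi>_def)
  ultimately show "\<exists>\<phi>. facial_nonrepetitive G rot \<phi> \<and> (\<forall>v\<in>pverts G. \<phi> v \<in> L v)"
    by blast
qed

section \<open>Stars, subdivided stars and wheels\<close>

text \<open>With two colours per list every leaf can avoid the colour of the centre. Each edge
  contains the centre, so a repetition would run through it and need its colour again.\<close>

lemma facial_choosable_star:
  assumes "c \<notin> A"
  shows "facial_choosable (star_graph c A) rot 2"
  unfolding facial_choosable_def
proof (intro allI impI)
  let ?G = "star_graph c A"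
  fix L :: "'a \<Rightarrow> nat set"
  assume "\<forall>v\<in>pverts ?G. L v \<subseteq> {0<..} \<and> (infinite (L v) \<or> 2 \<le> card (L v))"
  then have L: "infinite (L v) \<or> 2 \<le> card (L v)" if "v \<in> insert c A" for v
    using that by (auto simp: star_graph_def)
  have other: "\<exists>x\<in>L v. x \<noteq> y" if "v \<in> insert c A" for v y
  proof (rule ccontr)
    assume "\<not> (\<exists>x\<in>L v. x \<noteq> y)"
    then have "L v \<subseteq> {y}"
      by auto
    then have "finite (L v)" "card (L v) \<le> 1"
      using card_mono[of "{y}" "L v"] by (auto intro: finite_subset)
    then show False
      using L[OF that] by simp
  qed
  then obtain x where x: "x \<in> L c"
    by blast
  have "\<forall>v\<in>A. \<exists>y. y \<in> L v \<and> y \<noteq> x"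
    using other by blast
  then obtain f where f: "\<forall>v\<in>A. f v \<in> L v \<and> f v \<noteq> x"
    by (auto dest: bchoice)
  define \<phi> where "\<phi> = f(c := x)"
  have "facial_nonrepetitive ?G rot \<phi>"
    unfolding facial_nonrepetitive_def
  proof (intro allI impI notI)
    fix p assume "facial_path ?G rot p" and rep: "repetition (map \<phi> p)"
    note p = facial_pathD[OF this(1)]
    have "c \<notin> set p"
    proof
      assume "c \<in> set p"
      then obtain y where "y \<in> set p" "y \<noteq> c" "\<phi> y = \<phi> c"
        using repetition_colour_twice[OF rep p(1)] by blast
      then show False
        using p(2) f by (auto simp: \<phi>_def star_graph_def)
    qed
    then have "vwalk_arcs p = []"
      using p(3) vwalk_arcs_subset[of p] by (cases "vwalk_arcs p") (auto simp: star_graph_def)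
    then have "length p < 2"
      by (cases p rule: vwalk_arcs.cases) auto
    then show False
      using rep by (auto simp: repetition_def)
  qed
  moreover have "\<forall>v\<in>pverts ?G. \<phi> v \<in> L v"
    using x f by (auto simp: \<phi>_def star_graph_def)
  ultimately show "\<exists>\<phi>. facial_nonrepetitive ?G rot \<phi> \<and> (\<forall>v\<in>pverts ?G. \<phi> v \<in> L v)"
    by blast
qed

lemma pi_fl_star:
  assumes "c \<notin> A" "A \<noteq> {}"
  shows "pi_fl (star_graph c A) rot = 2"
  unfolding pi_fl_def
proof (rule Least_equality)
  show "facial_choosable (star_graph c A) rot 2"
    using assms(1) by (rule facial_choosable_star)
next
  fix l assume l: "facial_choosable (star_graph c A) rot l"
  show "2 \<le> l"
  proof (rule ccontr)
    assume "\<not> 2 \<le> l"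
    \<comment> \<open>The constant list \<open>{1}\<close> is positive and large enough for
      \<open>l = 0\<close> and \<open>l = 1\<close>; it forces all vertices to share a
      colour.\<close>
    then have "\<exists>\<phi> :: 'a \<Rightarrow> nat. facial_nonrepetitive (star_graph c A) rot \<phi> \<and>
        (\<forall>v\<in>insert c A. \<phi> v = 1)"
      using l[unfolded facial_choosable_def, rule_format, of "\<lambda>_. {1}"] by (simp add: star_graph_def)
    then obtain \<phi> :: "'a \<Rightarrow> nat"
      where \<phi>: "facial_nonrepetitive (star_graph c A) rot \<phi>" "\<forall>v\<in>insert c A. \<phi> v = 1"
      by blast
    obtain a where a: "a \<in> A"
      using assms(2) by blast
    \<comment> \<open>A single arc has no successor to check, so it follows a face for every
      \<open>rot\<close>.\<close>
    then have "facial_path (star_graph c A) rot [c, a]"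
      using assms(1) by (auto simp: facial_path_def follows_face_def vpath_def vwalk_def
          star_graph_def arcs_ends_def arc_to_ends_def)
    moreover have "repetition (map \<phi> [c, a])"
      using \<phi>(2) a by (auto simp: repetition_iff intro: exI[of _ "[1]"])
    ultimately show False
      using \<phi>(1) by (auto simp: facial_nonrepetitive_def)
  qed
qed

section \<open>Subdivided stars\<close>

text \<open>
  The list \<open>xs\<close> is a concatenation of the legs, each read from the centre \<open>c\<close> outwards, and \<open>H\<close>
  contains the first vertices of the legs.
\<close>

definition leg_arc :: "'a \<Rightarrow> 'a list \<Rightarrow> 'a set \<Rightarrow> 'a \<Rightarrow> 'a \<Rightarrow> bool" where
  "leg_arc c xs H a b \<longleftrightarrow> a = c \<and> b \<in> H \<or> sublist [a, b] xs \<and> b \<notin> H"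

text \<open>The invariant of the induction over subdivisions. Arcs are only bounded from above,
  which suffices for colouring. The condition \<open>b \<notin> H\<close> in \<open>leg_arc\<close>
  separates the legs: a vertex inserted in front of a head then breaks no edge between neighbours in
  \<open>xs\<close>.\<close>

definition star_like :: "'a \<Rightarrow> 'a list \<Rightarrow> 'a set \<Rightarrow> 'a pair_pre_digraph \<Rightarrow> bool" where
  "star_like c xs H G \<longleftrightarrow> distinct (c # xs) \<and> pverts G = insert c (set xs) \<and> H \<subseteq> set xs \<and>
     (\<forall>(a, b)\<in>parcs G. leg_arc c xs H a b \<or> leg_arc c xs H b a)"

text \<open>Inserting \<open>w\<close> in front of \<open>v\<close> destroys only the pair of
  \<open>last ys\<close> and \<open>v\<close>.\<close>

lemma sublist_pair_insert:
  assumes "sublist [a, b] (ys @ v # zs)" "b \<noteq> v \<or> ys = [] \<or> a \<noteq> last ys"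
  shows "sublist [a, b] (ys @ w # v # zs)"
proof -
  consider "sublist [a, b] ys" | "sublist [a, b] (v # zs)" | "suffix [a] ys" "b = v"
    using assms(1) by (auto simp: sublist_append Cons_eq_append_conv prefix_def)
  then show ?thesis
  proof cases
    case 2
    then have "sublist [a, b] ((ys @ [w]) @ (v # zs))"
      unfolding sublist_append by blast
    then show ?thesis
      by simp
  next
    case 3
    then show ?thesis
      using assms(2) by (auto simp: suffix_def)
  qed (simp add: sublist_append)
qed

text \<open>The new vertex is placed directly in front of \<open>v\<close>, the end of the edge
  farther from the centre. If \<open>v\<close> was the head of its leg, then \<open>w\<close> takes
  over that role.\<close>

lemma star_like_subdivide:
  assumes G: "star_like c xs H G" and w: "w \<notin> pverts G" and uv: "leg_arc c xs H u v"
  shows "\<exists>xs' H'. star_like c xs' H' (subdivide G (u, v) w)"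
proof -
  have xs: "distinct (c # xs)" "pverts G = insert c (set xs)" "H \<subseteq> set xs"
    and E: "\<And>a b. (a, b) \<in> parcs G \<Longrightarrow> leg_arc c xs H a b \<or> leg_arc c xs H b a"
    using G by (auto simp: star_like_def)
  have w': "w \<noteq> c" "w \<notin> set xs"
    using w xs(2) by auto
  \<comment> \<open>Survival is claimed for all potential leg arcs other than the subdivided one, so
    the two orientations of the arcs of \<open>G\<close> can be treated alike afterwards.\<close>
  have "\<exists>xs' H'. distinct (c # xs') \<and> set xs' = insert w (set xs) \<and> H' \<subseteq> set xs' \<and>
      leg_arc c xs' H' u w \<and> leg_arc c xs' H' w v \<and>
      (\<forall>a b. leg_arc c xs H a b \<and> (a, b) \<noteq> (u, v) \<longrightarrow> leg_arc c xs' H' a b)"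
    using uv unfolding leg_arc_def[of c xs H u v]
  proof (elim disjE conjE)
    assume u: "u = c" and v: "v \<in> H"
    then obtain ys zs where split: "xs = ys @ v # zs"
      using xs(3) by (meson in_set_conv_decomp subsetD)
    define xs' H' where "xs' = ys @ w # v # zs" and "H' = insert w (H - {v})"
    have "leg_arc c xs' H' a b" if ab: "leg_arc c xs H a b" "(a, b) \<noteq> (u, v)" for a b
    proof -
      consider "a = c" "b \<in> H" "b \<noteq> v" | "sublist [a, b] xs" "b \<notin> H"
        using ab u by (auto simp: leg_arc_def)
      then show ?thesis
      proof cases
        case 2
        then have "b \<noteq> w"
          using w' set_mono_sublist by fastforce
        moreover have "sublist [a, b] xs'"
          unfolding xs'_def using 2 v split by (intro sublist_pair_insert) auto
        ultimately show ?thesis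
          using 2 by (auto simp: leg_arc_def H'_def)
      qed (auto simp: leg_arc_def H'_def)
    qed
    moreover have "sublist [w, v] xs'"
      using sublist_appendI[of "[w, v]" ys zs] by (simp add: xs'_def)
    ultimately show ?thesis
      using xs w' u split v
      by (intro exI[of _ xs'] exI[of _ H']) (auto simp: leg_arc_def xs'_def H'_def)
  next
    assume uv: "sublist [u, v] xs" and v: "v \<notin> H"
    then obtain ys zs where split: "xs = ys @ u # v # zs"
      by (auto simp: sublist_def)
    define xs' where "xs' = ys @ u # w # v # zs"
    have "leg_arc c xs' H a b" if "leg_arc c xs H a b" "(a, b) \<noteq> (u, v)" for a b
      using that sublist_pair_insert[of a b "ys @ [u]" v zs w]
      by (auto simp: leg_arc_def xs'_def split)
    moreover have "sublist [u, w] xs'" "sublist [w, v] xs'"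
      using sublist_appendI[of "[u, w]" ys "v # zs"] sublist_appendI[of "[w, v]" "ys @ [u]" zs]
      by (simp_all add: xs'_def)
    ultimately show ?thesis
      using xs w' split v
      by (intro exI[of _ xs'] exI[of _ H]) (auto simp: leg_arc_def xs'_def)
  qed
  then obtain xs' H' where new: "distinct (c # xs')" "set xs' = insert w (set xs)" "H' \<subseteq> set xs'"
      "leg_arc c xs' H' u w" "leg_arc c xs' H' w v"
      "\<And>a b. leg_arc c xs H a b \<Longrightarrow> (a, b) \<noteq> (u, v) \<Longrightarrow> leg_arc c xs' H' a b"
    by blast
  have "leg_arc c xs' H' a b \<or> leg_arc c xs' H' b a"
    if "(a, b) \<in> parcs (subdivide G (u, v) w)" for a b
    using that E[of a b] new(4,5) new(6)[of a b] new(6)[of b a] by auto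
  then have "star_like c xs' H' (subdivide G (u, v) w)"
    using new(1,2,3) xs(2) by (auto simp: star_like_def)
  then show ?thesis
    by blast
qed

lemma subdivided_star_like:
  assumes "subdivision_pair G S" "is_star n G"
  shows "\<exists>c xs H. star_like c xs H S"
  using assms(1)
proof (induction rule: subdivision_pair_induct)
  case base
  obtain c A where A: "finite A" "c \<notin> A" "G = star_graph c A"
    using assms(2) by (auto simp: is_star_def)
  moreover obtain xs where "set xs = A" "distinct xs"
    using finite_distinct_list[OF A(1)] by blast
  \<comment> \<open>Before any subdivision each leg is a single vertex, so every entry of
    \<open>xs\<close> is a head.\<close>
  ultimately have "star_like c xs A G"
    by (auto simp: star_like_def leg_arc_def star_graph_def)
  then show ?case
    by blast
next
  case (divide e w S)
  then obtain c xs H where S: "star_like c xs H S"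
    by blast
  obtain u v where e: "e = (u, v)"
    by (cases e)
  \<comment> \<open>The divided arc may point towards the centre; reversing it gives the same
    subdivision.\<close>
  have "leg_arc c xs H u v \<or> leg_arc c xs H v u"
    using S divide e by (auto simp: star_like_def)
  moreover have "subdivide S (u, v) w = subdivide S (v, u) w"
    by (auto simp: subdivide.simps)
  ultimately show ?case
    using star_like_subdivide[OF S] divide unfolding e by metis
qed

lemma facial_choosable_star_like:
  assumes "star_like c xs H S"
  shows "facial_choosable S rot 5"
proof -
  have "facial_choosable S rot (card {c} + 4)"
    by (rule facial_choosable_near_path[of _ xs])
      (use assms in \<open>auto simp: star_like_def leg_arc_def\<close>)
  then show ?thesis
    by simp
qed

section \<open>Wheels\<close>

text \<open>Applied entrywise, the cycle rotates \<open>x # ys\<close> to \<open>ys @ [x]\<close>,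
  so only the last entry leaves \<open>ys\<close>, and it goes to \<open>x\<close>.\<close>

lemma sublist_cycle_of_list:
  assumes "distinct (x # ys)" "a \<in> set ys" "cycle_of_list (x # ys) a \<noteq> x"
  shows "sublist [a, cycle_of_list (x # ys) a] ys"
proof -
  obtain us vs where ys: "ys = us @ a # vs"
    using assms(2) by (meson in_set_conv_decomp)
  let ?r = "cycle_of_list (x # ys)"
  have "map ?r (x # ys) = ys @ [x]"
    using cyclic_rotation[OF assms(1), of 1] by simp
  \<comment> \<open>Both first blocks have length \<open>Suc (length us)\<close>, so the equation
    splits there; an empty \<open>vs\<close> would give \<open>?r a = x\<close>.\<close>
  then have "map ?r (x # us) @ ?r a # map ?r vs = (us @ [a]) @ vs @ [x]"
    by (simp add: ys)
  then have "?r a # map ?r vs = vs @ [x]"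
    by (subst (asm) append_eq_append_conv) auto
  then obtain vs' where "vs = ?r a # vs'"
    using assms(3) by (cases vs) auto
  then show ?thesis
    using ys sublist_appendI[of "[a, ?r a]" us vs'] by (metis append_Cons append_Nil)
qed

lemma facial_choosable_wheel:
  assumes "distinct (h # xs)" "xs \<noteq> []"
  shows "facial_choosable (wheel_graph h xs) rot 6"
proof -
  obtain x ys where xs: "xs = x # ys"
    using assms(2) by (cases xs) auto
  \<comment> \<open>Deleting the hub leaves the rim, and deleting \<open>x\<close> cuts it open into
    the path along \<open>ys\<close>.\<close>
  have "facial_choosable (wheel_graph h xs) rot (card {h, x} + 4)"
  proof (rule facial_choosable_near_path[of _ ys])
    fix a b assume "(a, b) \<in> parcs (wheel_graph h xs)" "a \<notin> {h, x}" "b \<notin> {h, x}"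
    then show "sublist [a, b] ys \<or> sublist [b, a] ys"
      using sublist_cycle_of_list[of x ys] assms(1) unfolding xs wheel_graph_def
      by (auto simp del: cycle_of_list.simps)
  qed (use assms(1) in \<open>auto simp: xs wheel_graph_def\<close>)
  then show ?thesis
    using assms(1) by (simp add: xs)
qed

theorem theorem6:
  fixes n :: nat
  assumes "1 \<le> n"
  shows "(\<forall>(G :: 'a pair_pre_digraph) rot.
            is_star n G \<and> plane_graph G rot \<longrightarrow> pi_fl G rot = 2)
       \<and> (\<forall>(G :: 'a pair_pre_digraph) S rot.
            is_star n G \<and> subdivision_pair G S \<and> plane_graph S rot \<longrightarrow> pi_fl S rot \<le> 5)
       \<and> (\<forall>(h :: 'a) xs.
            3 \<le> n \<and> length xs = n \<and> distinct (h # xs) \<longrightarrow>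
            pi_fl (wheel_graph h xs) (wheel_rot h xs) \<le> 6)"
proof (intro conjI allI impI)
  fix G :: "'a pair_pre_digraph" and rot
  assume "is_star n G \<and> plane_graph G rot"
  then obtain c A where "c \<notin> A" "card A = n" "G = star_graph c A"
    by (auto simp: is_star_def)
  then show "pi_fl G rot = 2"
    using assms by (auto intro!: pi_fl_star)
next
  fix G :: "'a pair_pre_digraph" and S rot
  assume "is_star n G \<and> subdivision_pair G S \<and> plane_graph S rot"
  then obtain c xs H where "star_like c xs H S"
    using subdivided_star_like[of G S n] by auto
  then have "facial_choosable S rot 5"
    by (rule facial_choosable_star_like)
  then show "pi_fl S rot \<le> 5"
    unfolding pi_fl_def by (rule Least_le)
next
  fix h :: 'a and xs
  assume "3 \<le> n \<and> length xs = n \<and> distinct (h # xs)"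
  then have "facial_choosable (wheel_graph h xs) (wheel_rot h xs) 6"
    by (intro facial_choosable_wheel) auto
  then show "pi_fl (wheel_graph h xs) (wheel_rot h xs) \<le> 6"
    unfolding pi_fl_def by (rule Least_le)
qed

end
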